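(* Let $m(T)\in\mathbb{R}[P,Q][T]$ be the monic polynomial in $T$ of minimal degree with $m(h)=0$ in $\mathbb{R}[x,y]$, and let $$\begin{aligned} R(T)={}&\tfrac{197}{4}T^6+\left(104-\tfrac{363}{2}P\right)T^5+\left(63-421P+\tfrac{825}{4}P^2\right)T^4\\ &+\left(-306P+510P^2-75P^3\right)T^3+\left(-Q+412P^2-195P^3\right)T^2\\ &+\left(2PQ-170P^3\right)T-P^2Q . \end{aligned}$$ Then $R(T)=\tfrac{197}{4}\,m(T)$.
   Context: The polynomials $P,Q,h\in\mathbb{R}[x,y]$ are those of the following specific Pinchuk map $F=(P,Q)$: put $t=xy-1$, $h=t(xt+1)$, $f=(xt+1)^2(t^2+y)$, $P=f+h$, and $Q=-t^2-6th(h+1)-u(f,h)$, where $u(f,h)=170fh+91h^2+195fh^2+69h^3+75fh^3+\tfrac{75}{4}h^4$. $P$ and $Q$ are algebraically independent over $\mathbb{R}$, and $T$ is an indeterminate. The element $h$ is integral over $\mathbb{R}[P,Q]$ (indeed $R(h)=0$), and $m$ is uniquely determined; it is the minimal polynomial of $h$ over $\mathbb{R}(P,Q)$. *)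

theory Defs
  imports Complex_Main "HOL-Computational_Algebra.Polynomial"
begin

(* R[x,y] is represented as (R[x])[y], i.e. by the type "real poly poly". *)
abbreviation const_xy :: "real \<Rightarrow> real poly poly" where
  "const_xy c \<equiv> [:[:c:]:]"

definition var_x :: "real poly poly" where
  "var_x = [:[:0, 1:]:]"

definition var_y :: "real poly poly" where
  "var_y = [:0, 1:]"

definition pinchuk_t :: "real poly poly" where
  "pinchuk_t = var_x * var_y - 1"

definition pinchuk_h :: "real poly poly" where
  "pinchuk_h = pinchuk_t * (var_x * pinchuk_t + 1)"

definition pinchuk_f :: "real poly poly" where
  "pinchuk_f = (var_x * pinchuk_t + 1)^2 * (pinchuk_t^2 + var_y)"

definition pinchuk_u :: "real poly poly \<Rightarrow> real poly poly \<Rightarrow> real poly poly" where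
  "pinchuk_u f h = 170 * f * h + 91 * h^2 + 195 * f * h^2 + 69 * h^3 + 75 * f * h^3
     + const_xy (75/4) * h^4"

definition pinchuk_P :: "real poly poly" where
  "pinchuk_P = pinchuk_f + pinchuk_h"

definition pinchuk_Q :: "real poly poly" where
  "pinchuk_Q = - (pinchuk_t^2) - 6 * pinchuk_t * pinchuk_h * (pinchuk_h + 1)
     - pinchuk_u pinchuk_f pinchuk_h"

(* The real subalgebra of R[x,y] generated by a set S, so that R[P,Q] is "adjoin_real {P, Q}". *)
inductive_set adjoin_real :: "real poly poly set \<Rightarrow> real poly poly set"
  for S :: "real poly poly set" where
  const: "const_xy c \<in> adjoin_real S"
| gen: "s \<in> S \<Longrightarrow> s \<in> adjoin_real S"
| add: "a \<in> adjoin_real S \<Longrightarrow> b \<in> adjoin_real S \<Longrightarrow> a + b \<in> adjoin_real S"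
| mult: "a \<in> adjoin_real S \<Longrightarrow> b \<in> adjoin_real S \<Longrightarrow> a * b \<in> adjoin_real S"

(* Polynomials in the indeterminate T over R[P,Q] are the elements of (R[x,y])[T], i.e. of
   "real poly poly poly", all of whose coefficients lie in the subring R[P,Q]. *)
definition monic_min_poly :: "real poly poly set \<Rightarrow> real poly poly \<Rightarrow> real poly poly poly \<Rightarrow> bool" where
  "monic_min_poly A a m \<longleftrightarrow>
     is_arg_min degree (\<lambda>p. (\<forall>i. coeff p i \<in> A) \<and> lead_coeff p = 1 \<and> poly p a = 0) m"

definition pinchuk_R :: "real poly poly poly" where
  "pinchuk_R = (let P = pinchuk_P; Q = pinchuk_Q in
     [: - (P^2 * Q),
        2 * P * Q - 170 * P^3,
        - Q + 412 * P^2 - 195 * P^3,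
        - 306 * P + 510 * P^2 - 75 * P^3,
        63 - 421 * P + const_xy (825/4) * P^2,
        104 - const_xy (363/2) * P,
        const_xy (197/4) :])"

end

theory Submission
  imports Defs
begin

text \<open>
  Write \<open>F = (T - P)\<^sup>2\<close>. The polynomial \<open>R\<close> is linear in \<open>Q\<close>: it has the form \<open>G(P,T) - Q F(P,T)\<close>,
  where \<open>G\<close> has degree 6 in \<open>T\<close>. The relation \<open>f (h - t) = h\<^sup>2 (h + 1)\<close> expresses \<open>t\<close> rationally by
  \<open>h\<close> and \<open>f = P - h\<close>; inserting this into the definition of \<open>Q\<close> and clearing denominators gives
  \<open>Q F(P,h) = G(P,h)\<close>, that is, \<open>R(h) = 0\<close> (\<open>pinchuk_curve\<close>).

  It remains to see that \<open>1, h, \<dots>, h\<^sup>5\<close> are linearly independent over \<open>\<real>[P,Q]\<close>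
  (\<open>pinchuk_h_powers_independent\<close>): this excludes monic annihilating polynomials of smaller degree,
  and it makes the one of degree 6 unique, since the difference of two of them has degree at most 5.
  Now \<open>P\<close> and \<open>h\<close> are algebraically independent; even more, \<open>(x,y) \<mapsto> (P,h)\<close> is birational, so a
  generic point of the plane is a value of \<open>(P,h)\<close> (\<open>pinchuk_P_h_attained\<close>). A linear relation of
  degree at most 5 in \<open>h\<close> can therefore be read as a polynomial identity in the independent
  variables \<open>P\<close>, \<open>h\<close> after \<open>Q = G/F\<close> is inserted and the denominator is cleared:
  \<open>\<Sum>\<^sub>j p\<^sub>j G\<^sup>j F\<^sup>N\<^sup>-\<^sup>j = 0\<close> with all \<open>p\<^sub>j\<close> of degree less than \<open>deg G\<close>. As \<open>F\<close> and \<open>G\<close> have no common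
  factor, such a relation is trivial (\<open>homogeneous_relation_trivial\<close>). This is the classical fact
  that \<open>K(h)\<close> has degree \<open>max (deg G) (deg F)\<close> over \<open>K(G/F)\<close>, in a form that needs no fraction
  fields.
\<close>

section \<open>Relations between two coprime polynomials\<close>

text \<open>
  Modulo \<open>F\<close> only the term \<open>p\<^sub>N G\<^sup>N\<close> survives, so \<open>p\<^sub>N = c F\<close>; after division by \<open>F\<close> the term
  \<open>c G\<^sup>N\<close> joins the one with index \<open>N - 1\<close>, whose new coefficient is \<open>p\<^sub>N\<^sub>-\<^sub>1 + c G\<close>. The induction
  hypothesis makes this coefficient vanish, which the degree bound on \<open>p\<^sub>N\<^sub>-\<^sub>1\<close> allows only for
  \<open>c = 0\<close>. The top coefficient is exempt from the degree bound because \<open>p\<^sub>N\<^sub>-\<^sub>1 + c G\<close> is not known to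
  satisfy it.
\<close>
lemma homogeneous_relation_trivial:
  fixes F G :: "'a::idom poly" and p :: "nat \<Rightarrow> 'a poly"
  assumes "F \<noteq> 0"
    and coprime: "\<And>c. F dvd c * G \<Longrightarrow> F dvd c"
    and "\<And>j. j < N \<Longrightarrow> degree (p j) < degree G"
    and "(\<Sum>j\<le>N. p j * G ^ j * F ^ (N - j)) = 0"
    and "j \<le> N"
  shows "p j = 0"
  using assms(3-5)
proof (induction N arbitrary: p j)
  case 0
  then show ?case by simp
next
  case (Suc N)
  let ?S = "\<Sum>j\<le>N. p j * G ^ j * F ^ (N - j)"
  have "(\<Sum>j\<le>N. p j * G ^ j * F ^ (Suc N - j)) = F * ?S"
    unfolding sum_distrib_left by (rule sum.cong) (auto simp: Suc_diff_le algebra_simps)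
  with Suc.prems(2) have rel: "F * ?S + p (Suc N) * G ^ Suc N = 0"
    by simp
  have coprime_power: "F dvd c" if "F dvd c * G ^ n" for c n
    using that by (induction n) (auto intro: coprime simp: power_Suc2 mult.assoc[symmetric] simp del: power_Suc)
  have "p (Suc N) * G ^ Suc N = F * (- ?S)"
    using rel by (simp add: add_eq_0_iff)
  then have "F dvd p (Suc N)"
    by (metis coprime_power dvd_triv_left)
  then obtain c where c: "p (Suc N) = F * c"
    by (elim dvdE)
  have "F * (?S + c * G * G ^ N) = 0"
    using rel c by (simp add: algebra_simps)
  then have cancelled: "?S + c * G * G ^ N = 0"
    using \<open>F \<noteq> 0\<close> by simp
  let ?p = "p(N := p N + c * G)"
  have "(\<Sum>j\<le>N. ?p j * G ^ j * F ^ (N - j)) = ?S + c * G * G ^ N"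
    by (cases N) (simp_all add: algebra_simps)
  then have vanish: "?p i = 0" if "i \<le> N" for i
    using that Suc.IH[of ?p i] Suc.prems(1) cancelled by simp
  have "c = 0"
  proof (rule ccontr)
    assume "c \<noteq> 0"
    have "G \<noteq> 0"
      using Suc.prems(1)[of N] by auto
    have "p N = - (c * G)"
      using vanish[of N] by (simp add: add_eq_0_iff2)
    then have "degree (p N) = degree c + degree G"
      using \<open>c \<noteq> 0\<close> \<open>G \<noteq> 0\<close> by (simp add: degree_mult_eq)
    then show False
      using Suc.prems(1)[of N] by simp
  qed
  show ?case
  proof (cases "j = Suc N")
    case True
    then show ?thesis using c \<open>c = 0\<close> by simp
  next
    case False
    then show ?thesis
      using vanish[of j] \<open>c = 0\<close> Suc.prems(3) by (auto split: if_splits)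
  qed
qed

lemma linear_power_dvd_cancel:
  fixes G c :: "'a::idom poly"
  assumes "poly G a \<noteq> 0" and "[:- a, 1:] ^ n dvd c * G"
  shows "[:- a, 1:] ^ n dvd c"
  using assms(2)
proof (induction n arbitrary: c)
  case (Suc n)
  have "[:- a, 1:] dvd c * G"
    using Suc.prems by (metis dvd_mult_left power_Suc)
  then have "poly c a = 0"
    using assms(1) by (simp add: poly_eq_0_iff_dvd [symmetric])
  then obtain d where d: "c = [:- a, 1:] * d"
    by (auto simp: poly_eq_0_iff_dvd)
  have "[:- a, 1:] * [:- a, 1:] ^ n dvd [:- a, 1:] * (d * G)"
    using Suc.prems by (simp only: d power_Suc mult.assoc)
  then have "[:- a, 1:] ^ n dvd d * G"
    by (subst (asm) dvd_mult_cancel_left) auto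
  then show ?case
    using Suc.IH[of d] unfolding d power_Suc by (intro mult_dvd_mono dvd_refl)
qed simp

section \<open>Polynomials in two variables as functions on the real plane\<close>

definition eval_xy :: "real \<Rightarrow> real \<Rightarrow> real poly poly \<Rightarrow> real" where
  "eval_xy u v q = poly (poly q [:v:]) u"

lemma eval_xy_simps [simp]:
  "eval_xy u v 0 = 0"
  "eval_xy u v 1 = 1"
  "eval_xy u v (numeral k) = numeral k"
  "eval_xy u v (p + q) = eval_xy u v p + eval_xy u v q"
  "eval_xy u v (p - q) = eval_xy u v p - eval_xy u v q"
  "eval_xy u v (- p) = - eval_xy u v p"
  "eval_xy u v (p * q) = eval_xy u v p * eval_xy u v q"
  "eval_xy u v (p ^ n) = eval_xy u v p ^ n"
  "eval_xy u v (const_xy c) = c"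
  "eval_xy u v var_x = u"
  "eval_xy u v var_y = v"
  by (simp_all add: eval_xy_def var_x_def var_y_def)

lemma eval_xy_pCons [simp]: "eval_xy u v (pCons a q) = poly a u + v * eval_xy u v q"
  by (simp add: eval_xy_def)

lemma eval_xy_smult [simp]: "eval_xy u v (smult a q) = poly a u * eval_xy u v q"
  by (simp add: eval_xy_def)

lemma eval_xy_sum [simp]: "eval_xy u v (sum g I) = (\<Sum>i\<in>I. eval_xy u v (g i))"
  by (simp add: eval_xy_def poly_sum)

lemma eval_xy_monom [simp]: "eval_xy u v (monom a n) = poly a u * v ^ n"
  by (simp add: eval_xy_def poly_monom)

lemma eval_xy_altdef:
  assumes "degree q \<le> N"
  shows "eval_xy u v q = (\<Sum>j\<le>N. poly (coeff q j) u * v ^ j)"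
proof -
  have "q = (\<Sum>j\<le>N. monom (coeff q j) j)"
    using assms by (simp add: poly_as_sum_of_monoms')
  then have "eval_xy u v q = eval_xy u v (\<Sum>j\<le>N. monom (coeff q j) j)"
    by simp
  then show ?thesis by simp
qed

lemma eval_xy_poly: "eval_xy u v (poly p a) = (\<Sum>i\<le>degree p. eval_xy u v (coeff p i) * eval_xy u v a ^ i)"
  by (simp add: poly_altdef)

lemma eval_xy_eq_0_imp_eq_0:
  assumes "\<And>u v. eval_xy u v q = 0"
  shows "q = 0"
proof -
  have const: "poly q [:v:] = 0" for v
    using assms unfolding eval_xy_def by (metis poly_all_0_iff_0)
  have "infinite (range (\<lambda>v::real. [:v:]))"
    by (simp add: finite_image_iff inj_def infinite_UNIV_char_0)
  moreover have "range (\<lambda>v::real. [:v:]) \<subseteq> {a. poly q a = 0}"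
    using const by auto
  ultimately show ?thesis
    using poly_roots_finite[of q] finite_subset by blast
qed

section \<open>The equation satisfied by \<open>P\<close>, \<open>Q\<close> and \<open>h\<close>\<close>

text \<open>
  The polynomials \<open>G\<close> and \<open>F\<close> with \<open>R = G - Q F\<close>; the inner variable stands for \<open>P\<close> and the outer
  one for \<open>T\<close>.
\<close>
definition curve_num :: "real poly poly" where
  "curve_num = [: 0, [:0, 0, 0, -170:], [:0, 0, 412, -195:], [:0, -306, 510, -75:],
     [:63, -421, 825/4:], [:104, -363/2:], [:197/4:] :]"

definition curve_den :: "real poly poly" where
  "curve_den = [:- [:0, 1:], 1:]\<^sup>2"

lemma degree_curve_num: "degree curve_num = 6"
  by (simp add: curve_num_def)

lemma curve_den_dvd_cancel: "curve_den dvd c * curve_num \<Longrightarrow> curve_den dvd c"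
proof -
  \<comment> \<open>At \<open>T = P\<close> the numerator is \<open>- P\<^sup>4 (P + 1)\<^sup>2\<close>, whose value at \<open>P = 1\<close> is \<open>-4\<close>.\<close>
  have "poly (poly curve_num [:0, 1:]) 1 = - 4"
    by (simp add: curve_num_def)
  then have "poly curve_num [:0, 1:] \<noteq> 0"
    by auto
  then show "curve_den dvd c * curve_num \<Longrightarrow> curve_den dvd c"
    unfolding curve_den_def by (rule linear_power_dvd_cancel)
qed

lemma eval_curve_den: "eval_xy p k curve_den = (k - p)\<^sup>2"
  by (simp add: curve_den_def)

text \<open>
  With \<open>s = x t + 1\<close> one has \<open>h = t s\<close> and \<open>y (s - 1) = t (t + 1)\<close>, and these two relations imply
  \<open>f (h - t) = h\<^sup>2 (h + 1)\<close>. Hence \<open>f t = f h - h\<^sup>2 (h + 1)\<close>, which turns \<open>f\<^sup>2 Q\<close> into a polynomial in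
  \<open>f\<close> and \<open>h\<close>.
\<close>
lemma pinchuk_curve:
  "eval_xy x y pinchuk_Q * eval_xy (eval_xy x y pinchuk_P) (eval_xy x y pinchuk_h) curve_den
   = eval_xy (eval_xy x y pinchuk_P) (eval_xy x y pinchuk_h) curve_num"
proof -
  define t where "t = x * y - 1"
  define h where "h = t * (x * t + 1)"
  define f where "f = (x * t + 1)\<^sup>2 * (t\<^sup>2 + y)"
  define w where "w = f * h - h\<^sup>2 * (h + 1)"
  define Q where "Q = - (t\<^sup>2) - 6 * t * h * (h + 1) - (170 * f * h + 91 * h\<^sup>2 + 195 * f * h\<^sup>2
     + 69 * h ^ 3 + 75 * f * h ^ 3 + 75/4 * h ^ 4)"
  have ft: "f * t = w"
    unfolding w_def f_def h_def t_def by algebra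
  have "Q * f\<^sup>2 = - (f * t)\<^sup>2 - 6 * (f * t) * f * h * (h + 1) - f\<^sup>2 * (170 * f * h + 91 * h\<^sup>2
     + 195 * f * h\<^sup>2 + 69 * h ^ 3 + 75 * f * h ^ 3 + 75/4 * h ^ 4)"
    unfolding Q_def by (simp add: power2_eq_square algebra_simps)
  also have "\<dots> = eval_xy (f + h) h curve_num"
    unfolding ft w_def curve_num_def
    by (simp add: power2_eq_square power3_eq_cube power4_eq_xxxx algebra_simps)
  finally have "Q * f\<^sup>2 = eval_xy (f + h) h curve_num" .
  moreover have "eval_xy x y pinchuk_h = h" "eval_xy x y pinchuk_P = f + h" "eval_xy x y pinchuk_Q = Q"
    by (simp_all add: pinchuk_h_def pinchuk_P_def pinchuk_Q_def pinchuk_f_def pinchuk_t_def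
        pinchuk_u_def Q_def f_def h_def t_def)
  ultimately show ?thesis
    by (simp add: eval_curve_den)
qed

lemma pinchuk_R_root: "poly pinchuk_R pinchuk_h = 0"
proof (rule eval_xy_eq_0_imp_eq_0)
  fix x y
  let ?P = "eval_xy x y pinchuk_P" and ?Q = "eval_xy x y pinchuk_Q" and ?h = "eval_xy x y pinchuk_h"
  have "eval_xy x y (poly pinchuk_R pinchuk_h) = eval_xy ?P ?h curve_num - ?Q * eval_xy ?P ?h curve_den"
    by (simp add: pinchuk_R_def Let_def curve_num_def eval_curve_den
        power2_eq_square power3_eq_cube algebra_simps)
  then show "eval_xy x y (poly pinchuk_R pinchuk_h) = 0"
    by (simp add: pinchuk_curve)
qed

section \<open>Algebraic independence of \<open>P\<close> and \<open>h\<close>\<close>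

text \<open>
  Inverting \<open>(x,y) \<mapsto> (P,h)\<close>: with \<open>s = x t + 1\<close> the quantity \<open>g = P - h - h\<^sup>2\<close> equals \<open>s\<^sup>2 y\<close>.
  Inserting \<open>t = h/s\<close> and \<open>y = g/s\<^sup>2\<close> into \<open>y (s - 1) = t (t + 1)\<close> leaves the equation
  \<open>g (s - 1) = h (h + s)\<close>, which is linear in \<open>s\<close>; finally \<open>x = (s - 1)/t\<close>.
\<close>
lemma pinchuk_P_h_attained:
  assumes "k \<noteq> 0" and "p - k \<noteq> 0" and "p - 2 * k - k\<^sup>2 \<noteq> 0"
  obtains x y where "eval_xy x y pinchuk_P = p" and "eval_xy x y pinchuk_h = k"
proof -
  define g where "g = p - k - k\<^sup>2"
  define s where "s = (p - k) / (p - 2 * k - k\<^sup>2)"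
  define t where "t = k / s"
  define y where "y = g / s\<^sup>2"
  define x where "x = (s - 1) / t"
  have "s \<noteq> 0"
    using assms by (simp add: s_def)
  have "t \<noteq> 0"
    using assms \<open>s \<noteq> 0\<close> by (simp add: t_def)
  have ts: "t * s = k"
    using \<open>s \<noteq> 0\<close> by (simp add: t_def)
  have sy: "s\<^sup>2 * y = g"
    using \<open>s \<noteq> 0\<close> by (simp add: y_def)
  have xt: "x * t + 1 = s"
    using \<open>t \<noteq> 0\<close> by (simp add: x_def)
  have "s * (p - 2 * k - k\<^sup>2) = p - k"
    using assms by (simp add: s_def)
  then have lin: "g * (s - 1) = k * (k + s)"
    by (simp add: g_def power2_eq_square algebra_simps)
  have "s\<^sup>2 * (t * (x * y)) = (s\<^sup>2 * y) * (x * t)"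
    by (simp add: algebra_simps)
  also have "\<dots> = k * (k + s)"
    using xt sy lin by (metis add_diff_cancel_right')
  also have "\<dots> = s\<^sup>2 * (t * (t + 1))"
    unfolding ts[symmetric] by (simp add: power2_eq_square algebra_simps)
  finally have t: "x * y - 1 = t"
    using \<open>s \<noteq> 0\<close> \<open>t \<noteq> 0\<close> by simp
  have "eval_xy x y pinchuk_h = k"
    by (simp add: pinchuk_h_def pinchuk_t_def t xt ts)
  moreover have "s\<^sup>2 * (t\<^sup>2 + y) = k\<^sup>2 + g"
    using ts sy by (auto simp: power2_eq_square algebra_simps)
  then have "eval_xy x y pinchuk_P = p"
    using calculation by (simp add: pinchuk_P_def pinchuk_f_def pinchuk_t_def t xt g_def)
  ultimately show ?thesis
    using that by blast
qed

lemma pinchuk_P_h_independent: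
  assumes "\<And>x y. eval_xy (eval_xy x y pinchuk_P) (eval_xy x y pinchuk_h) q = 0"
  shows "q = 0"
proof -
  \<comment> \<open>The locus where the inverse map has a vanishing denominator is the zero set of a polynomial.\<close>
  define D :: "real poly poly" where
    "D = var_y * (var_x - var_y) * (var_x - 2 * var_y - var_y\<^sup>2)"
  have "eval_xy p k (D * q) = 0" for p k
  proof (cases "eval_xy p k D = 0")
    case False
    then have "k \<noteq> 0" "p - k \<noteq> 0" "p - 2 * k - k\<^sup>2 \<noteq> 0"
      by (auto simp: D_def)
    then show ?thesis
      using assms by (metis eval_xy_simps(7) mult_zero_right pinchuk_P_h_attained)
  qed simp
  then have "D * q = 0"
    by (rule eval_xy_eq_0_imp_eq_0)
  moreover have "eval_xy 0 1 D \<noteq> 0"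
    by (simp add: D_def)
  then have "D \<noteq> 0"
    by auto
  ultimately show ?thesis by simp
qed

section \<open>Linear independence of the powers of \<open>h\<close>\<close>

lemma adjoin_real_pair_rep:
  assumes "a \<in> adjoin_real {p, q}"
  obtains \<phi> where "\<And>x y. eval_xy x y a = eval_xy (eval_xy x y p) (eval_xy x y q) \<phi>"
proof -
  have "\<exists>\<phi>. \<forall>x y. eval_xy x y a = eval_xy (eval_xy x y p) (eval_xy x y q) \<phi>"
    using assms
  proof induction
    case (const c)
    show ?case by (rule exI[of _ "const_xy c"]) simp
  next
    case (gen s)
    then consider "s = p" | "s = q" by blast
    then show ?case
      by cases (metis eval_xy_simps(10), metis eval_xy_simps(11))
  next
    case (add a b)
    then show ?case by (metis eval_xy_simps(4))
  next
    case (mult a b)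
    then show ?case by (metis eval_xy_simps(7))
  qed
  then show ?thesis using that by blast
qed

text \<open>
  Write the coefficients as \<open>\<phi>\<^sub>i(P,Q)\<close> and collect \<open>\<Sum>\<^sub>i \<phi>\<^sub>i(P,Q) h\<^sup>i\<close> by powers of \<open>Q\<close> instead: the
  coefficient of \<open>Q\<^sup>j\<close> is a polynomial \<open>b\<^sub>j(P,h)\<close> of degree at most 5 in \<open>h\<close>. Multiplication by
  \<open>F\<^sup>N\<close> and \<open>Q F = G\<close> lead to a homogeneous relation between \<open>F\<close> and \<open>G\<close>.
\<close>
lemma pinchuk_h_powers_independent:
  assumes coeffs: "\<And>i. coeff m i \<in> adjoin_real {pinchuk_P, pinchuk_Q}"
    and deg: "degree m < 6"
    and root: "poly m pinchuk_h = 0"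
  shows "m = 0"
proof -
  let ?P = "\<lambda>x y. eval_xy x y pinchuk_P" and ?Q = "\<lambda>x y. eval_xy x y pinchuk_Q"
    and ?h = "\<lambda>x y. eval_xy x y pinchuk_h"
  define n where "n = degree m"
  have "\<exists>\<phi>. \<forall>x y. eval_xy x y (coeff m i) = eval_xy (?P x y) (?Q x y) \<phi>" for i
    by (meson adjoin_real_pair_rep coeffs)
  then obtain \<phi> where \<phi>: "\<And>i x y. eval_xy x y (coeff m i) = eval_xy (?P x y) (?Q x y) (\<phi> i)"
    by metis
  define N where "N = (\<Sum>i\<le>n. degree (\<phi> i))"
  have N: "degree (\<phi> i) \<le> N" if "i \<le> n" for i
    unfolding N_def using that by (intro member_le_sum) auto
  define b where "b j = (\<Sum>i\<le>n. monom (coeff (\<phi> i) j) i)" for j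
  have degree_b: "degree (b j) < degree curve_num" for j
  proof -
    have "degree (b j) \<le> n"
      unfolding b_def by (intro degree_sum_le) (auto intro: order.trans[OF degree_monom_le])
    then show ?thesis
      using deg by (simp add: degree_curve_num n_def)
  qed
  have relation_in_Q: "(\<Sum>j\<le>N. eval_xy (?P x y) (?h x y) (b j) * ?Q x y ^ j) = 0" for x y
  proof -
    have "(\<Sum>j\<le>N. eval_xy (?P x y) (?h x y) (b j) * ?Q x y ^ j)
        = (\<Sum>j\<le>N. \<Sum>i\<le>n. poly (coeff (\<phi> i) j) (?P x y) * ?Q x y ^ j * ?h x y ^ i)"
      by (simp add: b_def sum_distrib_left mult_ac)
    also have "\<dots> = (\<Sum>i\<le>n. (\<Sum>j\<le>N. poly (coeff (\<phi> i) j) (?P x y) * ?Q x y ^ j) * ?h x y ^ i)"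
      unfolding sum_distrib_right by (rule sum.swap)
    also have "\<dots> = (\<Sum>i\<le>n. eval_xy x y (coeff m i) * ?h x y ^ i)"
      using N by (intro sum.cong refl) (simp add: \<phi> eval_xy_altdef[where N = N])
    also have "\<dots> = eval_xy x y (poly m pinchuk_h)"
      by (simp add: eval_xy_poly n_def)
    finally show ?thesis
      using root by simp
  qed
  have "(\<Sum>j\<le>N. b j * curve_num ^ j * curve_den ^ (N - j)) = 0"
  proof (rule pinchuk_P_h_independent)
    fix x y
    let ?e = "eval_xy (?P x y) (?h x y)"
    have "?e (\<Sum>j\<le>N. b j * curve_num ^ j * curve_den ^ (N - j))
        = (\<Sum>j\<le>N. ?e (b j) * (?Q x y * ?e curve_den) ^ j * ?e curve_den ^ (N - j))"
      by (simp add: pinchuk_curve)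
    also have "\<dots> = (\<Sum>j\<le>N. ?e curve_den ^ N * (?e (b j) * ?Q x y ^ j))"
    proof (intro sum.cong refl)
      fix j assume "j \<in> {..N}"
      then have "?e curve_den ^ N = ?e curve_den ^ j * ?e curve_den ^ (N - j)"
        by (simp flip: power_add)
      then show "?e (b j) * (?Q x y * ?e curve_den) ^ j * ?e curve_den ^ (N - j)
          = ?e curve_den ^ N * (?e (b j) * ?Q x y ^ j)"
        by (simp add: power_mult_distrib mult_ac)
    qed
    also have "\<dots> = 0"
      by (simp add: relation_in_Q flip: sum_distrib_left)
    finally show "?e (\<Sum>j\<le>N. b j * curve_num ^ j * curve_den ^ (N - j)) = 0" .
  qed
  moreover have "curve_den \<noteq> 0"
    by (simp add: curve_den_def)
  ultimately have b_0: "b j = 0" if "j \<le> N" for j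
    using homogeneous_relation_trivial[of curve_den curve_num N b j] curve_den_dvd_cancel degree_b that
    by blast
  have "coeff (\<phi> i) j = 0" if "i \<le> n" for i j
  proof (cases "j \<le> N")
    case True
    have "coeff (\<phi> i) j = coeff (b j) i"
      using that by (simp add: b_def coeff_sum)
    then show ?thesis
      using b_0[OF True] by simp
  next
    case False
    then show ?thesis
      using N[OF that] by (simp add: coeff_eq_0)
  qed
  then have "\<phi> i = 0" if "i \<le> n" for i
    using that by (simp add: poly_eq_iff)
  then have "eval_xy x y (coeff m n) = 0" for x y
    by (simp add: \<phi>)
  then have "coeff m n = 0"
    by (rule eval_xy_eq_0_imp_eq_0)
  then show ?thesis
    by (simp add: n_def)
qed

section \<open>The minimal polynomial\<close>

lemma adjoin_real_simps:
  shows adjoin_real_0: "0 \<in> adjoin_real S"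
    and adjoin_real_1: "1 \<in> adjoin_real S"
    and adjoin_real_numeral: "numeral k \<in> adjoin_real S"
  using adjoin_real.const[of 0 S] adjoin_real.const[of 1 S] adjoin_real.const[of "numeral k" S]
  by (simp_all add: numeral_poly pCons_one)

lemma adjoin_real_smult: "a \<in> adjoin_real S \<Longrightarrow> smult [:c:] a \<in> adjoin_real S"
  using adjoin_real.mult[OF adjoin_real.const[of c S], of a] by simp

lemma adjoin_real_uminus: "a \<in> adjoin_real S \<Longrightarrow> - a \<in> adjoin_real S"
proof -
  have "[:- 1:] = (- 1 :: real poly)"
    by (simp add: one_pCons)
  then show "a \<in> adjoin_real S \<Longrightarrow> - a \<in> adjoin_real S"
    using adjoin_real_smult[of a S "- 1"] by simp
qed

lemma adjoin_real_diff: "a \<in> adjoin_real S \<Longrightarrow> b \<in> adjoin_real S \<Longrightarrow> a - b \<in> adjoin_real S"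
  using adjoin_real.add[of a S "- b"] adjoin_real_uminus[of b S] by simp

lemma adjoin_real_power: "a \<in> adjoin_real S \<Longrightarrow> a ^ n \<in> adjoin_real S"
  by (induction n) (auto intro: adjoin_real_1 adjoin_real.mult)

lemma coeff_pCons_in:
  "c \<in> A \<Longrightarrow> (\<And>i. coeff p i \<in> A) \<Longrightarrow> coeff (pCons c p) i \<in> A"
  by (cases i) auto

lemma coeff_pinchuk_R: "coeff pinchuk_R i \<in> adjoin_real {pinchuk_P, pinchuk_Q}"
proof -
  have generators: "pinchuk_P \<in> adjoin_real {pinchuk_P, pinchuk_Q}"
      "pinchuk_Q \<in> adjoin_real {pinchuk_P, pinchuk_Q}"
    by (simp_all add: adjoin_real.gen)
  have coeff_0_in: "coeff 0 i \<in> adjoin_real {pinchuk_P, pinchuk_Q}" for i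
    by (simp add: adjoin_real_0)
  show ?thesis
    unfolding pinchuk_R_def Let_def
    by (intro coeff_pCons_in coeff_0_in generators adjoin_real_diff adjoin_real_uminus adjoin_real.add
        adjoin_real.mult adjoin_real_power adjoin_real_numeral adjoin_real.const)
qed

theorem proposition5:
  shows "(\<exists>!m. monic_min_poly (adjoin_real {pinchuk_P, pinchuk_Q}) pinchuk_h m) \<and>
         (\<forall>m. monic_min_poly (adjoin_real {pinchuk_P, pinchuk_Q}) pinchuk_h m \<longrightarrow>
              pinchuk_R = smult (const_xy (197/4)) m)"
proof -
  let ?A = "adjoin_real {pinchuk_P, pinchuk_Q}"
  let ?annihilates = "\<lambda>p. (\<forall>i. coeff p i \<in> ?A) \<and> lead_coeff p = 1 \<and> poly p pinchuk_h = 0"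
  define M where "M = smult (const_xy (4/197)) pinchuk_R"
  have R_M: "pinchuk_R = smult (const_xy (197/4)) M"
    by (simp add: M_def pCons_one)
  have degree_R: "degree pinchuk_R = 6" and lead_R: "coeff pinchuk_R 6 = const_xy (197/4)"
    by (simp_all add: pinchuk_R_def Let_def eval_nat_numeral)
  have degree_M: "degree M = 6"
    by (simp add: M_def degree_R)
  have M: "?annihilates M"
    using coeff_pinchuk_R pinchuk_R_root
    by (auto simp: M_def degree_R lead_R pCons_one intro: adjoin_real_smult)
  have small: "p = 0" if "\<forall>i. coeff p i \<in> ?A" "degree p < 6" "poly p pinchuk_h = 0" for p
    using that pinchuk_h_powers_independent by blast
  have not_smaller: "\<not> degree p < 6" if "?annihilates p" for p
    using that small[of p] by auto
  have "monic_min_poly ?A pinchuk_h M"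
    using M not_smaller by (auto simp: monic_min_poly_def is_arg_min_def degree_M)
  moreover have "m = M" if "monic_min_poly ?A pinchuk_h m" for m
  proof -
    have m: "?annihilates m" and "\<not> degree M < degree m"
      using that M by (auto simp: monic_min_poly_def is_arg_min_def)
    then have degree_m: "degree m = 6"
      using not_smaller[OF m] degree_M by simp
    have "coeff (m - M) i = 0" if "i \<ge> 6" for i
      using m M that degree_m degree_M by (cases "i = 6") (auto simp: coeff_eq_0)
    then have "degree (m - M) < 6"
      by (metis degree_0 leading_coeff_0_iff not_le zero_less_numeral)
    moreover have "\<forall>i. coeff (m - M) i \<in> ?A"
      using m M by (auto intro: adjoin_real_diff)
    moreover have "poly (m - M) pinchuk_h = 0"
      using m M by simp
    ultimately show "m = M"
      using small[of "m - M"] by simp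
  qed
  ultimately show ?thesis
    using R_M by blast
qed

end
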